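(* Let $(G,w)$ be a connected weighted graph (possibly infinite) with a pseudometrizable weight $w\colon E(G)\to[0,\infty)$. The weight $w$ admits a unique continuation to a pseudometric, and this pseudometric is not a metric (that is, $\mathfrak M_w=\{\rho\}$ for some pseudometric $\rho$ on $V(G)$ that is not a metric), if and only if the following two conditions hold simultaneously: (i) there exist $u,v\in V(G)$, $u\neq v$, such that $d_w(u,v)=0$; (ii) for every two distinct non-adjacent vertices $u,v\in V(G)$ such that $d_w(u,v)\neq 0$, the equality $$\sup_{P\in\mathcal P_{u,v}}\Bigl\{2\max_{e\in E(P)}w(e)-w(P)\Bigr\}=d_w(u,v)$$ holds. Moreover, if $\rho$ is the unique continuation of $w$, then $\rho(u,v)=d_w(u,v)$ for all $u,v\in V(G)$.
   Context: A graph $G=(V,E)$ consists of a nonempty set $V=V(G)$ of vertices (possibly infinite) and a (possibly empty) set $E=E(G)$ of unordered pairs of distinct elements of $V$. Vertices $u,v$ are adjacent if $\{u,v\}\in E(G)$. A path in $G$ is a finite subgraph $P$ with $V(P)=\{x_0,\dots,x_k\}$, all $x_i$ distinct, and $E(P)=\{\{x_0,x_1\},\dots,\{x_{k-1},x_k\}\}$; it joins $x_0$ and $x_k$. $G$ is connected if any two distinct vertices are joined by a path. $\mathcal P_{u,v}$ denotes the set of all paths in $G$ joining $u$ and $v$. A weighted graph $(G,w)$ is a graph $G$ with a weight $w\colon E(G)\to\mathbb R^+=[0,\infty)$. For a path $P$, $w(P)=\sum_{e\in E(P)}w(e)$. For connected $G$, the shortest-path pseudometric is $d_w(u,v)=\inf\{w(P):P\in\mathcal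 P_{u,v}\}$ for $u\ne v$, and $d_w(u,u)=0$. A pseudometric on a set $X$ is a function $d\colon X\times X\to[0,\infty)$ with $d(x,x)=0$, $d(x,y)=d(y,x)$ and $d(x,y)\le d(x,z)+d(z,y)$ for all $x,y,z\in X$; it is a metric if moreover $d(x,y)=0$ implies $x=y$. The weight $w$ is pseudometrizable if there is a pseudometric $d$ on $V(G)$ with $d(u,v)=w(\{u,v\})$ for all $\{u,v\}\in E(G)$. A continuation of a pseudometrizable weight $w$ is a pseudometric $\rho$ on $V(G)$ with $\rho(u,v)=w(\{u,v\})$ for every $\{u,v\}\in E(G)$; $\mathfrak M_w$ denotes the set of all continuations of $w$. *)

theory Defs
  imports Complex_Main "HOL-Library.FuncSet"
begin

record 'a graph =
  verts :: "'a set"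
  edges :: "'a set set"

definition is_graph :: "'a graph \<Rightarrow> bool" where
  "is_graph G \<longleftrightarrow> verts G \<noteq> {} \<and>
     edges G \<subseteq> {{u, v} | u v. u \<in> verts G \<and> v \<in> verts G \<and> u \<noteq> v}"

definition adjacent :: "'a graph \<Rightarrow> 'a \<Rightarrow> 'a \<Rightarrow> bool" where
  "adjacent G u v \<longleftrightarrow> {u, v} \<in> edges G"

definition subgraph :: "'a graph \<Rightarrow> 'a graph \<Rightarrow> bool" where
  "subgraph H G \<longleftrightarrow> verts H \<subseteq> verts G \<and> edges H \<subseteq> edges G"

text \<open>A path is a subgraph, not a vertex sequence; the enumeration \<open>x\<close> only witnesses its shape.\<close>

definition paths_between :: "'a graph \<Rightarrow> 'a \<Rightarrow> 'a \<Rightarrow> 'a graph set" where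
  "paths_between G u v = {P. subgraph P G \<and>
     (\<exists>(x :: nat \<Rightarrow> 'a) k. inj_on x {0..k} \<and> x 0 = u \<and> x k = v \<and>
        verts P = x ` {0..k} \<and> edges P = {{x i, x (Suc i)} | i. i < k})}"

definition connected_graph :: "'a graph \<Rightarrow> bool" where
  "connected_graph G \<longleftrightarrow>
     (\<forall>u\<in>verts G. \<forall>v\<in>verts G. u \<noteq> v \<longrightarrow> paths_between G u v \<noteq> {})"

definition weight_on :: "'a graph \<Rightarrow> ('a set \<Rightarrow> real) \<Rightarrow> bool" where
  "weight_on G w \<longleftrightarrow> w \<in> edges G \<rightarrow> {0..}"

definition path_weight :: "('a set \<Rightarrow> real) \<Rightarrow> 'a graph \<Rightarrow> real" where
  "path_weight w P = (\<Sum>e\<in>edges P. w e)"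

definition sp_dist :: "'a graph \<Rightarrow> ('a set \<Rightarrow> real) \<Rightarrow> 'a \<Rightarrow> 'a \<Rightarrow> real" where
  "sp_dist G w u v = (if u = v then 0 else Inf (path_weight w ` paths_between G u v))"

text \<open>Pseudometrics on \<open>X\<close> are extensional functions on \<open>X \<times> X\<close> (fixed to \<open>undefined\<close> elsewhere),
  so that HOL equality of two of them means agreement on \<open>X \<times> X\<close>. The locale \<open>Metric_space\<close> of
  \<open>HOL-Analysis\<close> is not used since it imposes nonnegativity and symmetry also outside the carrier.\<close>

definition pseudometric_on :: "'a set \<Rightarrow> ('a \<times> 'a \<Rightarrow> real) \<Rightarrow> bool" where
  "pseudometric_on X d \<longleftrightarrow> d \<in> X \<times> X \<rightarrow>\<^sub>E {0..} \<and>
     (\<forall>x\<in>X. d (x, x) = 0) \<and>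
     (\<forall>x\<in>X. \<forall>y\<in>X. d (x, y) = d (y, x)) \<and>
     (\<forall>x\<in>X. \<forall>y\<in>X. \<forall>z\<in>X. d (x, y) \<le> d (x, z) + d (z, y))"

definition metric_on :: "'a set \<Rightarrow> ('a \<times> 'a \<Rightarrow> real) \<Rightarrow> bool" where
  "metric_on X d \<longleftrightarrow> pseudometric_on X d \<and> (\<forall>x\<in>X. \<forall>y\<in>X. d (x, y) = 0 \<longrightarrow> x = y)"

definition continuations :: "'a graph \<Rightarrow> ('a set \<Rightarrow> real) \<Rightarrow> ('a \<times> 'a \<Rightarrow> real) set" where
  "continuations G w = {\<rho>. pseudometric_on (verts G) \<rho> \<and>
     (\<forall>u\<in>verts G. \<forall>v\<in>verts G. {u, v} \<in> edges G \<longrightarrow> \<rho> (u, v) = w {u, v})}"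

definition pseudometrizable :: "'a graph \<Rightarrow> ('a set \<Rightarrow> real) \<Rightarrow> bool" where
  "pseudometrizable G w \<longleftrightarrow> (\<exists>d. pseudometric_on (verts G) d \<and>
     (\<forall>u\<in>verts G. \<forall>v\<in>verts G. {u, v} \<in> edges G \<longrightarrow> d (u, v) = w {u, v}))"

text \<open>The supremum below is a genuine one whenever \<open>u \<noteq> v\<close>, \<open>G\<close> is connected and \<open>w\<close> is
  pseudometrizable: the set is nonempty and bounded above by \<open>\<rho> (u, v)\<close> for every continuation
  \<open>\<rho>\<close>, and each path has at least one edge, so \<open>Max\<close> ranges over a finite nonempty set.\<close>

definition sup_path_excess :: "'a graph \<Rightarrow> ('a set \<Rightarrow> real) \<Rightarrow> 'a \<Rightarrow> 'a \<Rightarrow> real" where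
  "sup_path_excess G w u v =
     (SUP P\<in>paths_between G u v. 2 * Max (w ` edges P) - path_weight w P)"

end

theory Submission
  imports Defs
begin

text \<open>Every continuation lies below the shortest-path pseudometric \<open>d\<close>, which is itself a continuation,
  and above every excess \<open>2 * w e - w P\<close>, because \<open>w e\<close> is at most the distance of the end points
  of \<open>P\<close> plus the weight of the rest of \<open>P\<close>. So equality of the supremum of the excesses with \<open>d\<close>
  forces uniqueness. Conversely, if the supremum \<open>S\<close> is smaller than \<open>d (u, v) > 0\<close>, joining \<open>u\<close>
  and \<open>v\<close> by a shortcut of length \<open>max S 0\<close> gives a second continuation: a shortcut through an
  edge \<open>{x, y}\<close> runs along a path from \<open>u\<close> to \<open>x\<close> and a path from \<open>y\<close> to \<open>v\<close>. If these meet, their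
  total weight is already at least \<open>w {x, y}\<close>; otherwise they and the edge form a path from \<open>u\<close>
  to \<open>v\<close> whose excess is at most \<open>S\<close>.\<close>

section \<open>Paths as vertex sequences\<close>

definition is_path_seq :: "'a graph \<Rightarrow> 'a \<Rightarrow> 'a \<Rightarrow> (nat \<Rightarrow> 'a) \<Rightarrow> nat \<Rightarrow> bool" where
  "is_path_seq G u v x k \<longleftrightarrow> inj_on x {0..k} \<and> x 0 = u \<and> x k = v \<and>
     x ` {0..k} \<subseteq> verts G \<and> (\<forall>i<k. {x i, x (Suc i)} \<in> edges G)"

definition seq_graph :: "(nat \<Rightarrow> 'a) \<Rightarrow> nat \<Rightarrow> 'a graph" where
  "seq_graph x k = \<lparr>verts = x ` {0..k}, edges = {{x i, x (Suc i)} | i. i < k}\<rparr>"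

definition seq_weight :: "('a set \<Rightarrow> real) \<Rightarrow> (nat \<Rightarrow> 'a) \<Rightarrow> nat \<Rightarrow> real" where
  "seq_weight w x k = (\<Sum>i<k. w {x i, x (Suc i)})"

text \<open>Being a subgraph reduces to conditions on the enumerated vertices and consecutive pairs,
  so later arguments can cut, reverse and glue sequences. The values of \<open>x\<close> beyond
  \<open>k\<close> are irrelevant.\<close>

lemma paths_between_eq:
  "paths_between G u v = {seq_graph x k | x k. is_path_seq G u v x k}"
proof (intro set_eqI iffI)
  fix P assume "P \<in> paths_between G u v"
  then obtain x k where "subgraph P G" "inj_on x {0..k}" "x 0 = u" "x k = v"
    and P: "verts P = x ` {0..k}" "edges P = {{x i, x (Suc i)} | i. i < k}"
    unfolding paths_between_def by blast
  then have "is_path_seq G u v x k"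
    unfolding is_path_seq_def subgraph_def by blast
  moreover have "P = seq_graph x k" using P by (simp add: seq_graph_def)
  ultimately show "P \<in> {seq_graph x k | x k. is_path_seq G u v x k}" by blast
next
  fix P assume "P \<in> {seq_graph x k | x k. is_path_seq G u v x k}"
  then obtain x k where "P = seq_graph x k" and x: "is_path_seq G u v x k" by blast
  then have P: "verts P = x ` {0..k}" "edges P = {{x i, x (Suc i)} | i. i < k}"
    by (simp_all add: seq_graph_def)
  then have "subgraph P G" using x unfolding is_path_seq_def subgraph_def by auto
  then show "P \<in> paths_between G u v"
    using x P unfolding is_path_seq_def paths_between_def by blast
qed

lemma edges_seq_graph: "edges (seq_graph x k) = (\<lambda>i. {x i, x (Suc i)}) ` {..<k}"
  by (auto simp: seq_graph_def)

text \<open>Two equal edges with different indices would have to match crosswise, forcing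
  \<open>i = Suc j\<close> and \<open>j = Suc i\<close>. Hence a sum over the edge set of a path is
  a sum over indices.\<close>

lemma inj_on_seq_edges:
  assumes "inj_on x {0..k}"
  shows "inj_on (\<lambda>i. {x i, x (Suc i)}) {..<k}"
proof (rule inj_onI)
  fix i j assume ij: "i \<in> {..<k}" "j \<in> {..<k}" and eq: "{x i, x (Suc i)} = {x j, x (Suc j)}"
  have "(x i = x j \<and> x (Suc i) = x (Suc j)) \<or> (x i = x (Suc j) \<and> x (Suc i) = x j)"
    using eq by (simp add: doubleton_eq_iff)
  then have "i = j \<or> (i = Suc j \<and> Suc i = j)"
    using ij inj_on_eq_iff[OF assms] by auto
  then show "i = j" by linarith
qed

lemma path_weight_seq_graph:
  "inj_on x {0..k} \<Longrightarrow> path_weight w (seq_graph x k) = seq_weight w x k"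
  by (simp add: path_weight_def edges_seq_graph sum.reindex[OF inj_on_seq_edges] seq_weight_def)

lemma is_path_seq_trivial: "u \<in> verts G \<Longrightarrow> is_path_seq G u u (\<lambda>_. u) 0"
  by (simp add: is_path_seq_def)

lemma is_path_seq_rev:
  assumes "is_path_seq G u v x k"
  shows "is_path_seq G v u (\<lambda>i. x (k - i)) k"
    and "seq_weight w (\<lambda>i. x (k - i)) k = seq_weight w x k"
proof -
  have inj: "inj_on x {0..k}" using assms by (simp add: is_path_seq_def)
  have "inj_on (\<lambda>i. x (k - i)) {0..k}"
    by (auto intro!: inj_onI dest!: inj_onD[OF inj])
  moreover have "{x (k - i), x (k - Suc i)} \<in> edges G" if "i < k" for i
  proof -
    \<comment> \<open>Edge \<open>i\<close> of the reversed sequence is edge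
      \<open>k - Suc i\<close> of the original one.\<close>
    have "k - Suc i < k" using that by simp
    then have "{x (k - Suc i), x (Suc (k - Suc i))} \<in> edges G"
      using assms unfolding is_path_seq_def by blast
    then show ?thesis using that by (simp add: Suc_diff_Suc insert_commute)
  qed
  ultimately show "is_path_seq G v u (\<lambda>i. x (k - i)) k"
    using assms by (auto simp: is_path_seq_def)
  have "seq_weight w (\<lambda>i. x (k - i)) k = (\<Sum>i<k. w {x (k - Suc i), x (Suc (k - Suc i))})"
    unfolding seq_weight_def by (rule sum.cong) (auto simp: Suc_diff_Suc insert_commute)
  then show "seq_weight w (\<lambda>i. x (k - i)) k = seq_weight w x k"
    by (simp only: seq_weight_def sum.nat_diff_reindex[of "\<lambda>i. w {x i, x (Suc i)}"])
qed

lemma is_path_seq_drop: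
  assumes "is_path_seq G u v x k" "i \<le> k"
  shows "is_path_seq G (x i) v (\<lambda>j. x (i + j)) (k - i)"
proof -
  have "inj_on x {0..k}" using assms by (simp add: is_path_seq_def)
  then have "inj_on (\<lambda>j. x (i + j)) {0..k - i}"
    using assms(2) by (auto intro!: inj_onI dest!: inj_onD)
  then show ?thesis using assms by (auto simp: is_path_seq_def)
qed

lemma seq_weight_split:
  assumes "i \<le> k"
  shows "seq_weight w x k = seq_weight w x i + seq_weight w (\<lambda>j. x (i + j)) (k - i)"
proof -
  have "seq_weight w x (i + m) = seq_weight w x i + seq_weight w (\<lambda>j. x (i + j)) m" for m
    by (induction m) (auto simp: seq_weight_def)
  from this[of "k - i"] assms show ?thesis by simp
qed

text \<open>The connecting edge becomes edge number \<open>k\<close>, so there are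
  \<open>k + 1 + l\<close> edges in all. Disjointness of the two vertex sets is what keeps the glued
  sequence injective.\<close>

lemma is_path_seq_join:
  assumes p: "is_path_seq G u x p k" and q: "is_path_seq G y v q l"
    and e: "{x, y} \<in> edges G" and disj: "p ` {0..k} \<inter> q ` {0..l} = {}"
  defines "r \<equiv> \<lambda>i. if i \<le> k then p i else q (i - Suc k)"
  shows "is_path_seq G u v r (Suc (k + l))"
    and "seq_weight w r (Suc (k + l)) = seq_weight w p k + w {x, y} + seq_weight w q l"
    and "{x, y} \<in> edges (seq_graph r (Suc (k + l)))"
proof -
  have ends: "p 0 = u" "p k = x" "q 0 = y" "q l = v"
    and inj: "inj_on p {0..k}" "inj_on q {0..l}"
    using p q by (auto simp: is_path_seq_def)
  have ne: "p i \<noteq> q j" if "i \<le> k" "j \<le> l" for i j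
    using disj that by fastforce
  have "inj_on r {0..Suc (k + l)}"
  proof (rule inj_onI)
    fix i j assume ij: "i \<in> {0..Suc (k + l)}" "j \<in> {0..Suc (k + l)}" and eq: "r i = r j"
    consider "i \<le> k" "j \<le> k" | "i \<le> k" "\<not> j \<le> k" | "\<not> i \<le> k" "j \<le> k" | "\<not> i \<le> k" "\<not> j \<le> k"
      by blast
    then show "i = j"
    proof cases
      case 1 then show ?thesis using eq inj_onD[OF inj(1)] by (auto simp: r_def)
    next
      case 2 then show ?thesis using eq ne[of i "j - Suc k"] ij by (simp add: r_def le_diff_conv)
    next
      case 3 then show ?thesis using eq ne[of j "i - Suc k"] ij by (simp add: r_def le_diff_conv)
    next
      case 4
      then have "i - Suc k = j - Suc k"
        using eq ij by (intro inj_onD[OF inj(2)]) (auto simp: r_def)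
      then show ?thesis using 4 by simp
    qed
  qed
  moreover have "r i \<in> verts G" if "i \<le> Suc (k + l)" for i
  proof (cases "i \<le> k")
    case True then show ?thesis using p by (auto simp: r_def is_path_seq_def)
  next
    case False
    then have "i - Suc k \<in> {0..l}" using that by auto
    then show ?thesis using q False by (auto simp: r_def is_path_seq_def)
  qed
  moreover have "{r i, r (Suc i)} \<in> edges G" if "i < Suc (k + l)" for i
  proof -
    consider "i < k" | "i = k" | "k < i" by linarith
    then show ?thesis
    proof cases
      case 1 then show ?thesis using p by (auto simp: r_def is_path_seq_def)
    next
      case 2 then show ?thesis using e ends by (simp add: r_def)
    next
      case 3
      then have "i - k = Suc (i - Suc k)" "i - Suc k < l" using that by auto
      then show ?thesis using q 3 by (auto simp: r_def is_path_seq_def)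
    qed
  qed
  ultimately show "is_path_seq G u v r (Suc (k + l))"
    using ends unfolding is_path_seq_def image_subset_iff by (simp add: r_def)
  have first: "seq_weight w r k = seq_weight w p k"
    unfolding seq_weight_def by (rule sum.cong) (auto simp: r_def)
  have last: "seq_weight w (\<lambda>j. r (Suc k + j)) l = seq_weight w q l"
    unfolding seq_weight_def by (rule sum.cong) (auto simp: r_def)
  have mid: "{r k, r (Suc k)} = {x, y}" using ends by (simp add: r_def)
  have "seq_weight w r (Suc k) = seq_weight w p k + w {x, y}"
    using first mid by (simp add: seq_weight_def)
  then show "seq_weight w r (Suc (k + l)) = seq_weight w p k + w {x, y} + seq_weight w q l"
    using seq_weight_split[of "Suc k" "Suc (k + l)" w r] last by simp
  show "{x, y} \<in> edges (seq_graph r (Suc (k + l)))"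
    using mid unfolding edges_seq_graph by (intro image_eqI[of _ _ k]) auto
qed

section \<open>Pseudometrics: bounds along a sequence, and shortcuts\<close>

lemma pseudometric_on_le_seq_weight:
  assumes \<rho>: "pseudometric_on V \<rho>" and x: "x ` {0..k} \<subseteq> V"
    and le: "\<And>i. i < k \<Longrightarrow> \<rho> (x i, x (Suc i)) \<le> w {x i, x (Suc i)}"
  shows "\<rho> (x 0, x k) \<le> seq_weight w x k"
  using x le
proof (induction k)
  case 0
  then show ?case using \<rho> by (auto simp: pseudometric_on_def seq_weight_def)
next
  case (Suc k)
  have "x 0 \<in> V" "x k \<in> V" "x (Suc k) \<in> V" using Suc.prems(1) by auto
  then have "\<rho> (x 0, x (Suc k)) \<le> \<rho> (x 0, x k) + \<rho> (x k, x (Suc k))"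
    using \<rho> unfolding pseudometric_on_def by blast
  moreover have "\<rho> (x 0, x k) \<le> seq_weight w x k"
    using Suc.prems by (intro Suc.IH) (auto simp: image_subset_iff)
  ultimately show ?case
    using Suc.prems(2)[of k] by (simp add: seq_weight_def)
qed

text \<open>The new distance allows at most one use of a shortcut of length \<open>c\<close> between
  \<open>u\<close> and \<open>v\<close>, in either direction. The triangle inequality holds because
  a second use never helps: two uses in the same direction are no shorter than one, and two in
  opposite directions are no shorter than going directly.\<close>

lemma pseudometric_on_shortcut:
  assumes d: "pseudometric_on V d" and uv: "u \<in> V" "v \<in> V" and c: "0 \<le> c"
  shows "pseudometric_on V (\<lambda>(x, y)\<in>V \<times> V.
    min (d (x, y)) (min (d (x, u) + c + d (v, y)) (d (x, v) + c + d (u, y))))"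
    (is "pseudometric_on V ?D")
proof -
  have nonneg: "0 \<le> d (x, y)" if "x \<in> V" "y \<in> V" for x y
    using d that by (auto simp: pseudometric_on_def PiE_iff)
  have sym: "d (x, y) = d (y, x)" if "x \<in> V" "y \<in> V" for x y
    using d that by (auto simp: pseudometric_on_def)
  have tri: "d (x, y) \<le> d (x, z) + d (z, y)" if "x \<in> V" "y \<in> V" "z \<in> V" for x y z
    using d that by (auto simp: pseudometric_on_def)
  have "?D \<in> V \<times> V \<rightarrow>\<^sub>E {0..}"
    using nonneg uv c by auto
  moreover have "?D (x, x) = 0" if "x \<in> V" for x
  proof -
    have "d (x, x) = 0" using d that by (simp add: pseudometric_on_def)
    then show ?thesis using that uv c nonneg by (simp add: min_absorb1)
  qed
  moreover have "?D (x, y) = ?D (y, x)" if "x \<in> V" "y \<in> V" for x y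
    using that uv sym[of x y] sym[of x u] sym[of x v] sym[of y u] sym[of y v] by (simp add: ac_simps)
  moreover have "?D (x, y) \<le> ?D (x, z) + ?D (z, y)" if V: "x \<in> V" "y \<in> V" "z \<in> V" for x y z
  proof -
    note ineqs = tri[OF V(1,2,3)] tri[OF V(1) uv(1) V(3)] tri[OF V(1) uv(2) V(3)]
      tri[OF uv(1) V(2,3)] tri[OF uv(2) V(2,3)]
      tri[OF V(1,2) uv(1)] tri[OF V(1,2) uv(2)]
      nonneg[OF uv(1) V(3)] nonneg[OF uv(2) V(3)]
      sym[OF uv(1) V(3)] sym[OF uv(2) V(3)]
    have le: "?D (x, y) \<le> d (x, y)" "?D (x, y) \<le> d (x, u) + c + d (v, y)"
      "?D (x, y) \<le> d (x, v) + c + d (u, y)"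
      using V by simp_all
    have cases: "?D (a, b) = d (a, b) \<or> ?D (a, b) = d (a, u) + c + d (v, b) \<or>
      ?D (a, b) = d (a, v) + c + d (u, b)" if "a \<in> V" "b \<in> V" for a b
      using that by (simp add: min_def)
    \<comment> \<open>Nine cases, by which term attains each of the two minima on the right.\<close>
    show ?thesis using cases[OF V(1,3)] cases[OF V(3,2)]
      by (elim disjE) (use le ineqs c in linarith)+
  qed
  ultimately show ?thesis unfolding pseudometric_on_def by blast
qed

section \<open>The shortest-path pseudometric\<close>

locale connected_weighted_graph =
  fixes G :: "'a graph" and w :: "'a set \<Rightarrow> real"
  assumes graph: "is_graph G" and connected: "connected_graph G" and weight: "weight_on G w"
begin

lemma edge_weight_nonneg: "e \<in> edges G \<Longrightarrow> 0 \<le> w e"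
  using weight by (auto simp: weight_on_def)

lemma edge_verts: "{x, y} \<in> edges G \<Longrightarrow> x \<in> verts G \<and> y \<in> verts G \<and> x \<noteq> y"
  using graph unfolding is_graph_def by (force simp: doubleton_eq_iff)

lemma seq_weight_nonneg: "is_path_seq G u v x k \<Longrightarrow> 0 \<le> seq_weight w x k"
  unfolding seq_weight_def is_path_seq_def by (auto intro!: sum_nonneg edge_weight_nonneg)

lemma path_seq_exists:
  assumes "u \<in> verts G" "v \<in> verts G"
  obtains x k where "is_path_seq G u v x k"
proof (cases "u = v")
  case True
  then show ?thesis using that is_path_seq_trivial[OF assms(1)] by blast
next
  case False
  then show ?thesis using that connected assms unfolding connected_graph_def paths_between_eq by blast
qed

lemma path_weights_eq:
  "path_weight w ` paths_between G u v = {seq_weight w x k | x k. is_path_seq G u v x k}"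
proof -
  have "path_weight w (seq_graph x k) = seq_weight w x k" if "is_path_seq G u v x k" for x k
    using that by (intro path_weight_seq_graph) (simp add: is_path_seq_def)
  then show ?thesis unfolding paths_between_eq by force
qed

lemma sp_dist_le:
  assumes "is_path_seq G u v x k"
  shows "sp_dist G w u v \<le> seq_weight w x k"
proof (cases "u = v")
  case True
  then show ?thesis using seq_weight_nonneg[OF assms] by (simp add: sp_dist_def)
next
  case False
  have "bdd_below {seq_weight w x k | x k. is_path_seq G u v x k}"
    by (auto intro!: bdd_belowI[of _ 0] seq_weight_nonneg)
  then show ?thesis
    using False assms unfolding sp_dist_def path_weights_eq by (auto intro!: cInf_lower)
qed

text \<open>Together with \<open>sp_dist_le\<close> this characterises \<open>sp_dist\<close> as a
  greatest lower bound. The case \<open>u = v\<close> fits in because the sequence with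
  \<open>k = 0\<close> has weight 0; connectedness makes the infimum range over a nonempty
  set.\<close>

lemma sp_dist_greatest:
  assumes uv: "u \<in> verts G" "v \<in> verts G"
    and le: "\<And>x k. is_path_seq G u v x k \<Longrightarrow> c \<le> seq_weight w x k"
  shows "c \<le> sp_dist G w u v"
proof (cases "u = v")
  case True
  then show ?thesis
    using le[of "\<lambda>_. u" 0] is_path_seq_trivial[OF uv(1)] by (simp add: sp_dist_def seq_weight_def)
next
  case False
  obtain x k where "is_path_seq G u v x k" using path_seq_exists[OF uv] .
  then show ?thesis
    using False le unfolding sp_dist_def path_weights_eq by (auto intro!: cInf_greatest)
qed

lemma sp_dist_nonneg: "u \<in> verts G \<Longrightarrow> v \<in> verts G \<Longrightarrow> 0 \<le> sp_dist G w u v"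
  by (rule sp_dist_greatest) (auto intro: seq_weight_nonneg)

lemma sp_dist_sym:
  assumes "u \<in> verts G" "v \<in> verts G"
  shows "sp_dist G w u v = sp_dist G w v u"
proof -
  have "sp_dist G w a b \<le> sp_dist G w b a" if "a \<in> verts G" "b \<in> verts G" for a b
  proof (rule sp_dist_greatest[OF that(2,1)])
    fix x k assume "is_path_seq G b a x k"
    from sp_dist_le[OF is_path_seq_rev(1)[OF this]] is_path_seq_rev(2)[OF this, of w]
    show "sp_dist G w a b \<le> seq_weight w x k" by simp
  qed
  from this[OF assms] this[OF assms(2,1)] show ?thesis by simp
qed

text \<open>Prepending the edge to a path from \<open>x\<close> gives a path from \<open>u\<close>,
  unless \<open>u\<close> already lies on it; then the tail starting at \<open>u\<close> is a path
  of no larger weight. This avoids extracting a path from the concatenation of two arbitrary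
  ones.\<close>

lemma sp_dist_edge_step:
  assumes e: "{u, x} \<in> edges G" and v: "v \<in> verts G"
  shows "sp_dist G w u v \<le> w {u, x} + sp_dist G w x v"
proof -
  have ux: "u \<in> verts G" "x \<in> verts G" using edge_verts[OF e] by auto
  have "sp_dist G w u v - w {u, x} \<le> sp_dist G w x v"
  proof (rule sp_dist_greatest[OF ux(2) v])
    fix p k assume p: "is_path_seq G x v p k"
    show "sp_dist G w u v - w {u, x} \<le> seq_weight w p k"
    proof (cases "u \<in> p ` {0..k}")
      case True
      then obtain i where i: "i \<le> k" "u = p i" by auto
      have "0 \<le> seq_weight w p i"
        using p i(1) unfolding seq_weight_def is_path_seq_def
        by (auto intro!: sum_nonneg edge_weight_nonneg)
      moreover have "sp_dist G w u v \<le> seq_weight w (\<lambda>j. p (i + j)) (k - i)"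
        using sp_dist_le[OF is_path_seq_drop[OF p i(1)]] i(2) by simp
      ultimately show ?thesis
        using seq_weight_split[OF i(1), of w p] edge_weight_nonneg[OF e] by linarith
    next
      case False
      then have disj: "(\<lambda>_. u) ` {0..0::nat} \<inter> p ` {0..k} = {}" by auto
      note j = is_path_seq_join[OF is_path_seq_trivial[OF ux(1)] p e disj]
      show ?thesis using sp_dist_le[OF j(1)] j(2)[of w] by (simp add: seq_weight_def)
    qed
  qed
  then show ?thesis by simp
qed

text \<open>Follow a path from \<open>u\<close> to \<open>z\<close> and apply
  \<open>sp_dist_edge_step\<close> to each of its edges.\<close>

lemma sp_dist_triangle:
  assumes "u \<in> verts G" "v \<in> verts G" "z \<in> verts G"
  shows "sp_dist G w u v \<le> sp_dist G w u z + sp_dist G w z v"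
proof -
  have "sp_dist G w u v - sp_dist G w z v \<le> sp_dist G w u z"
  proof (rule sp_dist_greatest[OF assms(1,3)])
    fix x k assume x: "is_path_seq G u z x k"
    have "sp_dist G w (x 0) v \<le> seq_weight w x i + sp_dist G w (x i) v" if "i \<le> k" for i
      using that
    proof (induction i)
      case 0
      show ?case by (simp add: seq_weight_def)
    next
      case (Suc i)
      then have "{x i, x (Suc i)} \<in> edges G" using x by (auto simp: is_path_seq_def)
      from sp_dist_edge_step[OF this assms(2)] Suc show ?case by (simp add: seq_weight_def)
    qed
    from this[of k] x show "sp_dist G w u v - sp_dist G w z v \<le> seq_weight w x k"
      by (simp add: is_path_seq_def)
  qed
  then show ?thesis by simp
qed

section \<open>Upper and lower bounds for all continuations\<close>

lemma continuation_le_sp_dist: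
  assumes \<rho>: "\<rho> \<in> continuations G w" and uv: "u \<in> verts G" "v \<in> verts G"
  shows "\<rho> (u, v) \<le> sp_dist G w u v"
proof (rule sp_dist_greatest[OF uv])
  fix x k assume x: "is_path_seq G u v x k"
  have "\<rho> (x 0, x k) \<le> seq_weight w x k"
    using \<rho> x edge_verts
    by (intro pseudometric_on_le_seq_weight[of "verts G"])
      (auto simp: continuations_def is_path_seq_def)
  then show "\<rho> (u, v) \<le> seq_weight w x k" using x by (simp add: is_path_seq_def)
qed

text \<open>Going from \<open>x i\<close> back to \<open>u\<close>, across to \<open>v\<close> and
  back to \<open>x (Suc i)\<close> bounds the weight of edge \<open>i\<close>. The two outer legs
  cost at most the rest of the path, that is, its weight minus that of edge
  \<open>i\<close>.\<close>

lemma edge_excess_le_continuation: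
  assumes \<rho>: "\<rho> \<in> continuations G w" and x: "is_path_seq G u v x k" and i: "i < k"
  shows "2 * w {x i, x (Suc i)} - seq_weight w x k \<le> \<rho> (u, v)"
proof -
  have pm: "pseudometric_on (verts G) \<rho>" using \<rho> by (simp add: continuations_def)
  have V: "x j \<in> verts G" if "j \<le> k" for j using x that by (auto simp: is_path_seq_def)
  have E: "\<rho> (x j, x (Suc j)) = w {x j, x (Suc j)}" if "j < k" for j
    using \<rho> x V that by (auto simp: continuations_def is_path_seq_def)
  have uv: "u = x 0" "v = x k" using x by (auto simp: is_path_seq_def)
  have "\<rho> (x 0, x i) \<le> seq_weight w x i"
    using V E i by (intro pseudometric_on_le_seq_weight[OF pm]) auto
  \<comment> \<open>The \<open>+ 0\<close> keeps the form of the shifted sequence at its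
    start.\<close>
  moreover have "\<rho> (x (Suc i + 0), x (Suc i + (k - Suc i)))
      \<le> seq_weight w (\<lambda>j. x (Suc i + j)) (k - Suc i)"
    by (rule pseudometric_on_le_seq_weight[OF pm, of "\<lambda>j. x (Suc i + j)"]) (use V E i in auto)
  moreover have "seq_weight w x k = seq_weight w x i + w {x i, x (Suc i)}
      + seq_weight w (\<lambda>j. x (Suc i + j)) (k - Suc i)"
    using seq_weight_split[of "Suc i" k w x] i by (simp add: seq_weight_def)
  moreover have "\<rho> (x i, x (Suc i)) \<le> \<rho> (x i, x 0) + \<rho> (x 0, x (Suc i))"
    "\<rho> (x 0, x (Suc i)) \<le> \<rho> (x 0, x k) + \<rho> (x k, x (Suc i))"
    "\<rho> (x i, x 0) = \<rho> (x 0, x i)" "\<rho> (x k, x (Suc i)) = \<rho> (x (Suc i), x k)"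
    using pm V[of i] V[of "Suc i"] V[of 0] V[of k] i unfolding pseudometric_on_def
    by (blast dest: less_imp_le Suc_leI)+
  ultimately show ?thesis using E[OF i] uv i by simp
qed

lemma path_excess_le_continuation:
  assumes \<rho>: "\<rho> \<in> continuations G w" and P: "P \<in> paths_between G u v" and "u \<noteq> v"
  shows "2 * Max (w ` edges P) - path_weight w P \<le> \<rho> (u, v)"
proof -
  obtain x k where P_eq: "P = seq_graph x k" and x: "is_path_seq G u v x k"
    using P by (auto simp: paths_between_eq)
  \<comment> \<open>Distinct ends force at least one edge, so \<open>Max\<close> is
    attained.\<close>
  have "k \<noteq> 0" using x \<open>u \<noteq> v\<close> unfolding is_path_seq_def by metis
  then have "Max (w ` edges P) \<in> w ` edges P"
    by (intro Max_in) (auto simp: P_eq edges_seq_graph lessThan_empty_iff)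
  then obtain i where "i < k" "Max (w ` edges P) = w {x i, x (Suc i)}"
    by (auto simp: P_eq edges_seq_graph)
  then show ?thesis
    using edge_excess_le_continuation[OF \<rho> x] x
    by (simp add: P_eq path_weight_seq_graph is_path_seq_def)
qed

lemma sup_path_excess_le_continuation:
  assumes "\<rho> \<in> continuations G w" and "u \<in> verts G" "v \<in> verts G" "u \<noteq> v"
  shows "sup_path_excess G w u v \<le> \<rho> (u, v)"
  unfolding sup_path_excess_def
  using connected assms
  by (intro cSUP_least path_excess_le_continuation) (auto simp: connected_graph_def)

end

section \<open>The shortest-path continuation and shorter ones\<close>

locale pseudometrizable_graph = connected_weighted_graph +
  assumes pseudometrizable: "pseudometrizable G w"
begin

definition sp_continuation :: "'a \<times> 'a \<Rightarrow> real" where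
  "sp_continuation = (\<lambda>(x, y)\<in>verts G \<times> verts G. sp_dist G w x y)"

lemma continuation_exists: obtains \<rho> where "\<rho> \<in> continuations G w"
  using pseudometrizable by (auto simp: pseudometrizable_def continuations_def)

text \<open>The edge is itself a path, which gives one inequality. Pseudometrizability gives the
  other: any continuation lies below \<open>sp_dist\<close> and takes the value
  \<open>w {x, y}\<close>, so no detour is shorter than the edge.\<close>

lemma sp_dist_edge:
  assumes e: "{x, y} \<in> edges G"
  shows "sp_dist G w x y = w {x, y}"
proof (rule antisym)
  have V: "x \<in> verts G" "y \<in> verts G" using edge_verts[OF e] by auto
  show "sp_dist G w x y \<le> w {x, y}"
    using sp_dist_edge_step[OF e V(2)] by (simp add: sp_dist_def)
  obtain \<rho> where \<rho>: "\<rho> \<in> continuations G w" using continuation_exists .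
  show "w {x, y} \<le> sp_dist G w x y"
    using continuation_le_sp_dist[OF \<rho> V] \<rho> V e by (simp add: continuations_def)
qed

lemma sp_continuation_in_continuations: "sp_continuation \<in> continuations G w"
proof -
  have "sp_continuation \<in> verts G \<times> verts G \<rightarrow>\<^sub>E {0..}"
    using sp_dist_nonneg by (auto simp: sp_continuation_def)
  moreover have "sp_continuation (x, x) = 0" if "x \<in> verts G" for x
    using that by (simp add: sp_continuation_def sp_dist_def)
  ultimately show ?thesis
    using sp_dist_triangle sp_dist_sym sp_dist_edge
    by (simp add: continuations_def pseudometric_on_def sp_continuation_def)
qed

text \<open>This is the reason why a shortcut of length \<open>c\<close> between \<open>u\<close>
  and \<open>v\<close> leaves edge weights unchanged. It is shown for two fixed paths first, then
  both infima are taken.\<close>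

lemma shortcut_through_edge:
  assumes e: "{x, y} \<in> edges G" and uv: "u \<in> verts G" "v \<in> verts G" "u \<noteq> v"
    and c: "sup_path_excess G w u v \<le> c" "0 \<le> c"
  shows "w {x, y} \<le> sp_dist G w u x + c + sp_dist G w y v"
proof -
  have V: "x \<in> verts G" "y \<in> verts G" using edge_verts[OF e] by auto
  have paths: "w {x, y} \<le> seq_weight w p k + c + seq_weight w q l"
    if p: "is_path_seq G u x p k" and q: "is_path_seq G y v q l" for p k q l
  proof (cases "p ` {0..k} \<inter> q ` {0..l} = {}")
    case True
    define r where "r = (\<lambda>i. if i \<le> k then p i else q (i - Suc k))"
    let ?P = "seq_graph r (Suc (k + l))"
    note j = is_path_seq_join[OF p q e True, folded r_def]
    have P: "?P \<in> paths_between G u v" using j(1) by (auto simp: paths_between_eq)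
    \<comment> \<open>The edge need not be the heaviest one: the excess of \<open>?P\<close> is
      still at least \<open>w {x, y}\<close> minus the weights of \<open>p\<close> and
      \<open>q\<close>.\<close>
    have "w {x, y} \<le> Max (w ` edges ?P)"
      using j(3) by (intro Max_ge) (auto simp: edges_seq_graph)
    moreover have "path_weight w ?P = seq_weight w p k + w {x, y} + seq_weight w q l"
      using j(1,2) by (simp add: path_weight_seq_graph is_path_seq_def)
    moreover have "2 * Max (w ` edges ?P) - path_weight w ?P \<le> sup_path_excess G w u v"
      unfolding sup_path_excess_def
      \<comment> \<open>The shortest-path continuation bounds all excesses, so the supremum is an
        upper bound.\<close>
      using path_excess_le_continuation[OF sp_continuation_in_continuations _ uv(3)] P
      by (intro cSUP_upper) (auto intro!: bdd_aboveI2)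
    ultimately show ?thesis using c by linarith
  next
    case False
    then obtain i j where ij: "i \<le> k" "j \<le> l" "p i = q j" by auto
    define z where "z = p i"
    have z: "z \<in> verts G" using p ij(1) by (auto simp: is_path_seq_def z_def)
    have nonneg: "0 \<le> seq_weight w s m"
      if "is_path_seq G a b s n" "m \<le> n" for s m n a b
      using that unfolding seq_weight_def is_path_seq_def
      by (auto intro!: sum_nonneg edge_weight_nonneg)
    have "sp_dist G w z x \<le> seq_weight w p k"
      using sp_dist_le[OF is_path_seq_drop[OF p ij(1)]] seq_weight_split[OF ij(1), of w p]
        nonneg[OF p ij(1)] by (simp add: z_def)
    moreover have "sp_dist G w z y \<le> seq_weight w q l"
    proof -
      \<comment> \<open>In the reversed \<open>q\<close> the common vertex has index
        \<open>l - j\<close>; dropping that many edges leaves a path from it to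
        \<open>y\<close>.\<close>
      have r: "is_path_seq G v y (\<lambda>i. q (l - i)) l" "l - j \<le> l"
        using is_path_seq_rev(1)[OF q] by auto
      show ?thesis
        using sp_dist_le[OF is_path_seq_drop[OF r]] seq_weight_split[OF r(2), of w "\<lambda>i. q (l - i)"]
          nonneg[OF r] is_path_seq_rev(2)[OF q, of w] ij by (simp add: z_def)
    qed
    moreover have "w {x, y} \<le> sp_dist G w z x + sp_dist G w z y"
      using sp_dist_triangle[OF V z] sp_dist_sym[OF V(1) z] sp_dist_edge[OF e] by simp
    ultimately show ?thesis using c(2) by linarith
  qed
  have "w {x, y} - c - sp_dist G w y v \<le> sp_dist G w u x"
  proof (rule sp_dist_greatest[OF uv(1) V(1)])
    fix p k assume p: "is_path_seq G u x p k"
    have "w {x, y} - c - seq_weight w p k \<le> sp_dist G w y v"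
      using paths[OF p] by (intro sp_dist_greatest V uv) (simp add: algebra_simps)
    then show "w {x, y} - c - sp_dist G w y v \<le> seq_weight w p k" by simp
  qed
  then show ?thesis by simp
qed

lemma shorter_continuation_exists:
  assumes uv: "u \<in> verts G" "v \<in> verts G" "u \<noteq> v"
    and c: "sup_path_excess G w u v \<le> c" "0 \<le> c"
  obtains \<rho> where "\<rho> \<in> continuations G w" "\<rho> (u, v) \<le> c"
proof -
  let ?d = sp_continuation
  define \<rho> where "\<rho> = (\<lambda>(x, y)\<in>verts G \<times> verts G.
    min (?d (x, y)) (min (?d (x, u) + c + ?d (v, y)) (?d (x, v) + c + ?d (u, y))))"
  have "pseudometric_on (verts G) \<rho>"
    unfolding \<rho>_def using sp_continuation_in_continuations
    by (intro pseudometric_on_shortcut uv c) (simp add: continuations_def)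
  moreover have "\<rho> (x, y) = w {x, y}"
    if V: "x \<in> verts G" "y \<in> verts G" and e: "{x, y} \<in> edges G" for x y
  proof -
    \<comment> \<open>Both orientations of the edge are needed, one for each direction of the
      shortcut.\<close>
    have comm: "{y, x} = {x, y}" by blast
    then have e': "{y, x} \<in> edges G" using e by (simp only:)
    have "w {x, y} \<le> sp_dist G w x u + c + sp_dist G w v y"
      using shortcut_through_edge[OF e uv c] sp_dist_sym[OF V(1) uv(1)] sp_dist_sym[OF V(2) uv(2)]
      by linarith
    moreover have "w {x, y} \<le> sp_dist G w x v + c + sp_dist G w u y"
      using shortcut_through_edge[OF e' uv c] sp_dist_sym[OF V(1) uv(2)] sp_dist_sym[OF V(2) uv(1)]
      unfolding comm by linarith
    ultimately show ?thesis
      using V uv sp_dist_edge[OF e] by (simp add: \<rho>_def sp_continuation_def min_absorb1)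
  qed
  ultimately have "\<rho> \<in> continuations G w" by (simp add: continuations_def)
  \<comment> \<open>The second term of the minimum is \<open>c\<close>, as its outer distances
    vanish.\<close>
  moreover have "\<rho> (u, v) \<le> c"
    using uv by (simp add: \<rho>_def sp_continuation_def sp_dist_def)
  ultimately show ?thesis using that by blast
qed

section \<open>Uniqueness of the continuation\<close>

lemma unique_continuation_eq:
  assumes "continuations G w = {\<rho>}"
  shows "\<rho> = sp_continuation"
  using sp_continuation_in_continuations assms by simp

lemma unique_continuation_imp_sup_path_excess:
  assumes uniq: "continuations G w = {\<rho>}" and uv: "u \<in> verts G" "v \<in> verts G" "u \<noteq> v"
    and pos: "sp_dist G w u v \<noteq> 0"
  shows "sup_path_excess G w u v = sp_dist G w u v"
proof (rule antisym)
  have \<rho>: "\<rho> (u, v) = sp_dist G w u v"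
    using unique_continuation_eq[OF uniq] uv by (simp add: sp_continuation_def)
  show "sup_path_excess G w u v \<le> sp_dist G w u v"
    using sup_path_excess_le_continuation[of \<rho>, OF _ uv] uniq \<rho> by simp
  \<comment> \<open>A shortcut length must be nonnegative, whereas the supremum may be negative;
    \<open>pos\<close> removes the \<open>max\<close> at the end.\<close>
  obtain \<rho>' where "\<rho>' \<in> continuations G w" "\<rho>' (u, v) \<le> max (sup_path_excess G w u v) 0"
    using shorter_continuation_exists[OF uv, of "max (sup_path_excess G w u v) 0"] by auto
  then have "sp_dist G w u v \<le> max (sup_path_excess G w u v) 0" using uniq \<rho> by simp
  then show "sp_dist G w u v \<le> sup_path_excess G w u v"
    using pos sp_dist_nonneg[OF uv(1,2)] by linarith
qed

text \<open>Each value of a continuation is squeezed against \<open>sp_dist\<close>: from below by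
  the supremum, or by 0 where \<open>sp_dist\<close> vanishes. On adjacent pairs the weight fixes
  it.\<close>

lemma unique_continuation_if_sup_path_excess:
  assumes eq: "\<And>u v. \<lbrakk>u \<in> verts G; v \<in> verts G; u \<noteq> v; \<not> adjacent G u v; sp_dist G w u v \<noteq> 0\<rbrakk>
      \<Longrightarrow> sup_path_excess G w u v = sp_dist G w u v"
  shows "continuations G w = {sp_continuation}"
proof -
  have "\<rho> = sp_continuation" if \<rho>: "\<rho> \<in> continuations G w" for \<rho>
  \<comment> \<open>Continuations are extensional, so agreement on pairs of vertices gives equality
    of functions.\<close>
  proof (rule PiE_ext)
    show "\<rho> \<in> verts G \<times> verts G \<rightarrow>\<^sub>E {0..}"
      using \<rho> by (simp add: continuations_def pseudometric_on_def)
    show "sp_continuation \<in> verts G \<times> verts G \<rightarrow>\<^sub>E {0..}"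
      using sp_continuation_in_continuations by (simp add: continuations_def pseudometric_on_def)
    fix p assume "p \<in> verts G \<times> verts G"
    then obtain u v where p: "p = (u, v)" and uv: "u \<in> verts G" "v \<in> verts G" by auto
    have nonneg: "0 \<le> \<rho> (u, v)"
      using \<rho> uv by (auto simp: continuations_def pseudometric_on_def)
    have "\<rho> (u, v) = sp_dist G w u v"
    proof (cases "adjacent G u v")
      case True
      then show ?thesis using \<rho> uv sp_dist_edge by (simp add: adjacent_def continuations_def)
    next
      case False
      have "sp_dist G w u v \<le> \<rho> (u, v)"
      proof (cases "sp_dist G w u v = 0")
        case True
        then show ?thesis using nonneg by simp
      next
        case pos: False
        then have "u \<noteq> v" by (auto simp: sp_dist_def)
        then show ?thesis
          using eq[OF uv _ False pos] sup_path_excess_le_continuation[OF \<rho> uv] by simp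
      qed
      then show ?thesis using continuation_le_sp_dist[OF \<rho> uv] by simp
    qed
    then show "\<rho> p = sp_continuation p" using p uv by (simp add: sp_continuation_def)
  qed
  then show ?thesis using sp_continuation_in_continuations by blast
qed

text \<open>Turns the failure of the only candidate to be a metric into condition (i).\<close>

lemma sp_continuation_metric_on_iff:
  "metric_on (verts G) sp_continuation \<longleftrightarrow>
    \<not> (\<exists>u\<in>verts G. \<exists>v\<in>verts G. u \<noteq> v \<and> sp_dist G w u v = 0)"
  using sp_continuation_in_continuations
  by (auto simp: metric_on_def continuations_def sp_continuation_def)

end

theorem corollary2p11:
  fixes G :: "'a graph" and w :: "'a set \<Rightarrow> real"
  assumes "is_graph G" and "connected_graph G"
    and "weight_on G w" and "pseudometrizable G w"
  shows "((\<exists>\<rho>. continuations G w = {\<rho>} \<and> \<not> metric_on (verts G) \<rho>) \<longleftrightarrow>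
           (\<exists>u\<in>verts G. \<exists>v\<in>verts G. u \<noteq> v \<and> sp_dist G w u v = 0) \<and>
           (\<forall>u\<in>verts G. \<forall>v\<in>verts G.
              u \<noteq> v \<and> \<not> adjacent G u v \<and> sp_dist G w u v \<noteq> 0 \<longrightarrow>
              sup_path_excess G w u v = sp_dist G w u v))
       \<and> (\<forall>\<rho>. continuations G w = {\<rho>} \<longrightarrow>
           (\<forall>u\<in>verts G. \<forall>v\<in>verts G. \<rho> (u, v) = sp_dist G w u v))"
    (is "(?unique \<longleftrightarrow> ?zero \<and> ?excess) \<and> ?dist")
proof -
  interpret pseudometrizable_graph G w
    using assms by unfold_locales
  have ?dist
    by (auto dest!: unique_continuation_eq simp: sp_continuation_def)
  moreover have "?zero \<and> ?excess" if ?unique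
  proof -
    obtain \<rho> where \<rho>: "continuations G w = {\<rho>}" "\<not> metric_on (verts G) \<rho>"
      using \<open>?unique\<close> by blast
    then have ?zero
      using unique_continuation_eq[OF \<rho>(1)] sp_continuation_metric_on_iff by simp
    then show ?thesis using unique_continuation_imp_sup_path_excess[OF \<rho>(1)] by blast
  qed
  moreover have ?unique if "?zero \<and> ?excess"
    using that unique_continuation_if_sup_path_excess sp_continuation_metric_on_iff by blast
  ultimately show ?thesis by blast
qed

end
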